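(* Let $\mathcal A$ be a semisimple commutative separable unital Banach algebra, let $G$ be an abelian compact Hausdorff group, and let $1\le p<\infty$. If $L^p(G,\mathcal A)$ is a BSE-norm algebra, then $\mathcal A$ is a BSE-norm algebra. Conversely, if $G$ is finite, $\mathcal A$ is unital, and $\mathcal A$ is a BSE-norm algebra, then $L^p(G,\mathcal A)$ is a BSE-norm algebra.
   Context: All algebras are over $\mathbb C$. For a commutative Banach algebra $\mathcal B$, $\Delta(\mathcal B)$ is the set of nonzero multiplicative linear functionals on $\mathcal B$, and $\widehat b(\varphi)=\varphi(b)$ $(\varphi\in\Delta(\mathcal B))$ is the Gelfand transform of $b$. $\mathcal B$ is semisimple if $\widehat b=0$ implies $b=0$. For $b\in\mathcal B$, $\|\widehat b\|_{BSE}$ is the infimum of all $\beta>0$ such that $\left|\sum_{k=1}^n\alpha_k\varphi_k(b)\right|\le\beta\left\|\sum_{k=1}^n\alpha_k\varphi_k\right\|_{\mathcal B^*}$ for all $n$, $\alpha_1,\dots,\alpha_n\in\mathbb C$, $\varphi_1,\dots,\varphi_n\in\Delta(\mathcal B)$ (always $\|\widehat b\|_{BSE}\le\|b\|_{\mathcal B}$). $\mathcal B$ is a BSE-norm algebra if there is $K>0$ with $\|b\|_{\mathcal B}\le K\|\widehat b\|_{BSE}$ for all $b\in\mathcal B$. $\lambda$ is the Haar measure on $G$ with $\lambda(G)=1$. $L^p(G,\mathcal A)$ is the space of (classes modulo $\lambda$-a.e. equality of) Borel measurable $f:G\to\mathcal A$ with $\|f\|_{p,\mathcal A}=\left(\int_G\|f(x)\|_{\mathcal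 A}^p\,d\lambda(x)\right)^{1/p}<\infty$, a commutative Banach algebra under convolution $(f*g)(x)=\int_G f(y)g(y^{-1}x)\,d\lambda(y)$. *)

theory Defs
  imports "HOL-Analysis.Analysis"
begin

section \<open>Commutative complex Banach algebras\<close>

text \<open>
  The scalar action is compatible with the real one of the library, so that \<open>scaleC 1 x = x\<close>
  follows from the axioms of real vector spaces. No unit is required.
\<close>

class comm_complex_banach_algebra = real_normed_algebra + comm_ring + banach +
  fixes scaleC :: "complex \<Rightarrow> 'a \<Rightarrow> 'a"
  assumes scaleC_of_real: "scaleC (complex_of_real r) x = scaleR r x"
    and scaleC_add_right: "scaleC c (x + y) = scaleC c x + scaleC c y"
    and scaleC_add_left: "scaleC (c + d) x = scaleC c x + scaleC d x"
    and scaleC_scaleC: "scaleC c (scaleC d x) = scaleC (c * d) x"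
    and scaleC_mult_left: "scaleC c x * y = scaleC c (x * y)"
    and norm_scaleC: "norm (scaleC c x) = cmod c * norm x"

text \<open>
  The algebra \<open>L\<^sup>p(G, A)\<close> depends on the number \<open>p\<close> and therefore cannot be a type. The notions
  below are formulated for algebras with an explicit carrier, so that one and the same definition
  applies to \<open>A\<close> and to \<open>L\<^sup>p(G, A)\<close>.
\<close>

record 'b calgebra =
  carrier :: "'b set"
  zero :: "'b"
  add :: "'b \<Rightarrow> 'b \<Rightarrow> 'b"
  scale :: "complex \<Rightarrow> 'b \<Rightarrow> 'b"
  mult :: "'b \<Rightarrow> 'b \<Rightarrow> 'b"
  nrm :: "'b \<Rightarrow> real"

definition type_algebra :: "'a::comm_complex_banach_algebra calgebra" where
  "type_algebra =
     \<lparr>carrier = UNIV, zero = 0, add = (+), scale = scaleC, mult = (*), nrm = norm\<rparr>"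

definition unital :: "'b calgebra \<Rightarrow> bool" where
  "unital B \<longleftrightarrow>
     (\<exists>e\<in>carrier B. \<forall>b\<in>carrier B. mult B e b = b \<and> mult B b e = b)"

text \<open>The values of a functional outside the carrier are irrelevant.\<close>

definition characters :: "'b calgebra \<Rightarrow> ('b \<Rightarrow> complex) set" where
  "characters B = {\<phi>.
     (\<forall>x\<in>carrier B. \<forall>y\<in>carrier B. \<phi> (add B x y) = \<phi> x + \<phi> y) \<and>
     (\<forall>c. \<forall>x\<in>carrier B. \<phi> (scale B c x) = c * \<phi> x) \<and>
     (\<forall>x\<in>carrier B. \<forall>y\<in>carrier B. \<phi> (mult B x y) = \<phi> x * \<phi> y) \<and>
     (\<exists>x\<in>carrier B. \<phi> x \<noteq> 0)}"

definition gelfand :: "'b \<Rightarrow> ('b \<Rightarrow> complex) \<Rightarrow> complex" where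
  "gelfand b \<phi> = \<phi> b"

definition semisimple :: "'b calgebra \<Rightarrow> bool" where
  "semisimple B \<longleftrightarrow>
     (\<forall>b\<in>carrier B. (\<forall>\<phi>\<in>characters B. gelfand b \<phi> = 0) \<longrightarrow> b = zero B)"

text \<open>
  The operator norm is taken in the extended nonnegative reals to avoid a junk value for unbounded
  functionals. It is finite for linear combinations of characters of a Banach algebra, since
  characters are automatically bounded.
\<close>

definition dual_norm :: "'b calgebra \<Rightarrow> ('b \<Rightarrow> complex) \<Rightarrow> ennreal" where
  "dual_norm B \<psi> = (SUP x\<in>{x \<in> carrier B. nrm B x \<le> 1}. ennreal (cmod (\<psi> x)))"

text \<open>The infimum is over a set containing \<open>nrm B b + 1\<close> and bounded below by \<open>0\<close>.\<close>

definition bse_norm :: "'b calgebra \<Rightarrow> 'b \<Rightarrow> real" where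
  "bse_norm B b = Inf {\<beta>. \<beta> > 0 \<and>
     (\<forall>(n::nat) (\<alpha> :: nat \<Rightarrow> complex) (\<phi> :: nat \<Rightarrow> 'b \<Rightarrow> complex).
        (\<forall>k<n. \<phi> k \<in> characters B) \<longrightarrow>
        ennreal (cmod (\<Sum>k<n. \<alpha> k * gelfand b (\<phi> k)))
          \<le> ennreal \<beta> * dual_norm B (\<lambda>x. \<Sum>k<n. \<alpha> k * \<phi> k x))}"

definition bse_norm_algebra :: "'b calgebra \<Rightarrow> bool" where
  "bse_norm_algebra B \<longleftrightarrow> (\<exists>K>0. \<forall>b\<in>carrier B. nrm B b \<le> K * bse_norm B b)"


section \<open>Normalised Haar measure\<close>

text \<open>
  The abelian group is written additively. On a compact Hausdorff abelian group there is exactly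
  one such measure; regularity matters only if the group is not metrizable.
\<close>

definition normalized_haar ::
    "'g::{topological_ab_group_add, t2_space} measure \<Rightarrow> bool" where
  "normalized_haar \<mu> \<longleftrightarrow>
     sets \<mu> = sets borel \<and>
     emeasure \<mu> UNIV = 1 \<and>
     (\<forall>x. \<forall>B\<in>sets borel. emeasure \<mu> ((\<lambda>y. x + y) ` B) = emeasure \<mu> B) \<and>
     (\<forall>B\<in>sets borel. emeasure \<mu> B = (INF U\<in>{U. open U \<and> B \<subseteq> U}. emeasure \<mu> U)) \<and>
     (\<forall>U. open U \<longrightarrow> emeasure \<mu> U = (SUP K\<in>{K. compact K \<and> K \<subseteq> U}. emeasure \<mu> K))"


section \<open>The convolution algebra of vector-valued p-integrable functions\<close>

text \<open>
  Separability of \<open>A\<close> is expressed by the class \<open>second_countable_topology\<close>, which for metric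
  spaces is equivalent to it and which the Bochner integral requires.
\<close>

definition lp_fun :: "'g::topological_space measure \<Rightarrow> real \<Rightarrow>
    ('g \<Rightarrow> 'a::{comm_complex_banach_algebra, second_countable_topology}) set" where
  "lp_fun \<mu> p =
     {f \<in> borel_measurable borel. (\<integral>\<^sup>+x. ennreal (norm (f x) powr p) \<partial>\<mu>) < \<infinity>}"

definition lp_class :: "'g::topological_space measure \<Rightarrow> real \<Rightarrow>
    ('g \<Rightarrow> 'a::{comm_complex_banach_algebra, second_countable_topology}) \<Rightarrow> ('g \<Rightarrow> 'a) set" where
  "lp_class \<mu> p f = {g \<in> lp_fun \<mu> p. AE x in \<mu>. f x = g x}"

definition rep :: "'c set \<Rightarrow> 'c" where
  "rep F = (SOME f. f \<in> F)"

text \<open>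
  For \<open>p \<ge> 1\<close> and \<open>f, g\<close> in \<open>L\<^sup>p\<close> the integrand is integrable for almost every \<open>x\<close>; for the other
  \<open>x\<close> the Bochner integral is \<open>0\<close> by convention.
\<close>

definition convolution :: "'g::{topological_space, ab_group_add} measure \<Rightarrow>
    ('g \<Rightarrow> 'a::{comm_complex_banach_algebra, second_countable_topology}) \<Rightarrow> ('g \<Rightarrow> 'a) \<Rightarrow>
    'g \<Rightarrow> 'a" where
  "convolution \<mu> f g x = (\<integral>y. f y * g (- y + x) \<partial>\<mu>)"

text \<open>
  All operations respect equality almost everywhere, so the choice of representatives is
  immaterial.
\<close>

definition lp_algebra :: "'g::{topological_ab_group_add, t2_space} measure \<Rightarrow> real \<Rightarrow>
    ('g \<Rightarrow> 'a::{comm_complex_banach_algebra, second_countable_topology}) set calgebra" where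
  "lp_algebra \<mu> p =
     \<lparr>carrier = lp_class \<mu> p ` lp_fun \<mu> p,
      zero = lp_class \<mu> p (\<lambda>_. 0),
      add = (\<lambda>F H. lp_class \<mu> p (\<lambda>x. rep F x + rep H x)),
      scale = (\<lambda>c F. lp_class \<mu> p (\<lambda>x. scaleC c (rep F x))),
      mult = (\<lambda>F H. lp_class \<mu> p (convolution \<mu> (rep F) (rep H))),
      nrm = (\<lambda>F. (\<integral>x. norm (rep F x) powr p \<partial>\<mu>) powr (1 / p))\<rparr>"

end

theory Submission
  imports Defs "HOL-Probability.Probability_Measure"
begin

text \<open>
  A homomorphism \<open>h\<close> with \<open>\<parallel>h x\<parallel> \<le> C \<parallel>x\<parallel>\<close> satisfies
  \<open>\<parallel>h x\<parallel>\<^sub>B\<^sub>S\<^sub>E \<le> C \<parallel>x\<parallel>\<^sub>B\<^sub>S\<^sub>E\<close>, because characters of the target pull back to characters or to \<open>0\<close>.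
  The first implication applies this to the isometric embedding of \<open>A\<close> as constant functions, which
  is multiplicative since the Haar measure has total mass \<open>1\<close>. For finite \<open>G\<close> it is applied to the
  finitely many Fourier coefficients \<open>L\<^sup>p(G, A) \<rightarrow> A\<close>, which control the norm by Fourier inversion.
\<close>

section \<open>The BSE norm under bounded homomorphisms\<close>

text \<open>The condition on a single \<beta> inside the infimum that defines
  \<open>bse_norm\<close>, so that homomorphisms can be studied bound by bound before the infimum is
  taken.\<close>

definition bse_bound :: "'b calgebra \<Rightarrow> 'b \<Rightarrow> real \<Rightarrow> bool" where
  "bse_bound B b \<beta> \<longleftrightarrow> \<beta> > 0 \<and>
     (\<forall>(n::nat) (\<alpha> :: nat \<Rightarrow> complex) (\<phi> :: nat \<Rightarrow> 'b \<Rightarrow> complex).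
        (\<forall>k<n. \<phi> k \<in> characters B) \<longrightarrow>
        ennreal (cmod (\<Sum>k<n. \<alpha> k * \<phi> k b))
          \<le> ennreal \<beta> * dual_norm B (\<lambda>x. \<Sum>k<n. \<alpha> k * \<phi> k x))"

lemma bse_norm_eq: "bse_norm B b = Inf {\<beta>. bse_bound B b \<beta>}"
  by (simp add: bse_norm_def bse_bound_def gelfand_def)

text \<open>Isolates what is needed to rescale a vector into the unit ball, the one normed-space
  argument made below.\<close>

definition normed_scale :: "'b calgebra \<Rightarrow> bool" where
  "normed_scale B \<longleftrightarrow> (\<forall>c. \<forall>x\<in>carrier B.
     scale B c x \<in> carrier B \<and> nrm B (scale B c x) = cmod c * nrm B x)"

lemma le_dual_norm:
  assumes "x \<in> carrier B" "nrm B x \<le> 1"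
  shows "ennreal (cmod (\<psi> x)) \<le> dual_norm B \<psi>"
  unfolding dual_norm_def using assms by (intro SUP_upper) auto

text \<open>Scale \<open>x\<close> by \<open>1 / r\<close> into the unit ball. Allowing
  \<open>r\<close> to exceed the norm avoids division by zero when
  \<open>nrm B x = 0\<close>.\<close>

lemma cmod_le_dual_norm:
  assumes B: "normed_scale B" and x: "x \<in> carrier B" and r: "nrm B x \<le> r" "0 < r"
    and \<psi>: "\<And>c y. y \<in> carrier B \<Longrightarrow> \<psi> (scale B c y) = c * \<psi> y"
  shows "ennreal (cmod (\<psi> x)) \<le> ennreal r * dual_norm B \<psi>"
proof -
  let ?y = "scale B (of_real (1 / r)) x"
  have y: "?y \<in> carrier B" "nrm B ?y = (1 / r) * nrm B x"
    using B x r by (auto simp: normed_scale_def norm_divide simp del: of_real_divide)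
  have "cmod (\<psi> x) = r * cmod (\<psi> ?y)"
    using r x by (simp add: \<psi> norm_mult norm_divide)
  also have "ennreal \<dots> = ennreal r * ennreal (cmod (\<psi> ?y))"
    using r by (simp add: ennreal_mult)
  also have "\<dots> \<le> ennreal r * dual_norm B \<psi>"
    using y r by (intro mult_left_mono le_dual_norm) auto
  finally show ?thesis .
qed

lemma character_scale:
  "\<phi> \<in> characters B \<Longrightarrow> x \<in> carrier B \<Longrightarrow> \<phi> (scale B c x) = c * \<phi> x"
  by (simp add: characters_def)

lemma character_sum_scale:
  assumes "\<And>k. k < n \<Longrightarrow> \<phi> k \<in> characters B" "x \<in> carrier B"
  shows "(\<Sum>k<n. \<alpha> k * \<phi> k (scale B c x)) = c * (\<Sum>k<(n::nat). \<alpha> k * \<phi> k x)"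
  using assms by (simp add: character_scale sum_distrib_left mult.left_commute)

text \<open>Makes the set in the BSE infimum nonempty, without which a lower bound of the set says
  nothing about \<open>Inf\<close>.\<close>

lemma bse_bound_nrm:
  assumes "normed_scale B" "b \<in> carrier B" "nrm B b \<le> r" "0 < r"
  shows "bse_bound B b r"
  unfolding bse_bound_def
proof (intro conjI allI impI)
  fix n :: nat and \<alpha> and \<phi> :: "nat \<Rightarrow> 'a \<Rightarrow> complex"
  assume "\<forall>k<n. \<phi> k \<in> characters B"
  then show "ennreal (cmod (\<Sum>k<n. \<alpha> k * \<phi> k b))
      \<le> ennreal r * dual_norm B (\<lambda>x. \<Sum>k<n. \<alpha> k * \<phi> k x)"
    using assms cmod_le_dual_norm[where \<psi> = "\<lambda>x. \<Sum>k<n. \<alpha> k * \<phi> k x"]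
    by (simp add: character_sum_scale)
qed (use assms in auto)

definition alg_hom :: "'b calgebra \<Rightarrow> 'c calgebra \<Rightarrow> ('b \<Rightarrow> 'c) \<Rightarrow> bool" where
  "alg_hom X Y h \<longleftrightarrow>
     (\<forall>x\<in>carrier X. h x \<in> carrier Y \<and>
        (\<forall>y\<in>carrier X. h (add X x y) = add Y (h x) (h y) \<and> h (mult X x y) = mult Y (h x) (h y)) \<and>
        (\<forall>c. h (scale X c x) = scale Y c (h x)))"

text \<open>The image of \<open>h\<close> may lie in the kernel of \<phi>, so a point where the
  pullback does not vanish has to be assumed.\<close>

lemma alg_hom_pullback:
  assumes h: "alg_hom X Y h" and \<phi>: "\<phi> \<in> characters Y"
    and nz: "x \<in> carrier X" "\<phi> (h x) \<noteq> 0"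
  shows "(\<lambda>x. \<phi> (h x)) \<in> characters X"
  using h \<phi> nz unfolding characters_def alg_hom_def by auto

text \<open>Evaluating characters of \<open>Y\<close> at \<open>h b\<close> means evaluating their
  pullbacks at \<open>b\<close>, and composition with \<open>h\<close> raises the dual norm at most
  by the factor \<open>C\<close>.\<close>

lemma bse_bound_hom:
  assumes X: "normed_scale X" and h: "alg_hom X Y h"
    and C: "0 < C" "\<And>x. x \<in> carrier X \<Longrightarrow> nrm Y (h x) \<le> C * nrm X x"
    and b: "b \<in> carrier X" and \<beta>: "bse_bound X b \<beta>"
  shows "bse_bound Y (h b) (C * \<beta>)"
  unfolding bse_bound_def
proof (intro conjI allI impI)
  show "0 < C * \<beta>"
    using C \<beta> by (simp add: bse_bound_def)
next
  fix n :: nat and \<alpha> and \<phi> :: "nat \<Rightarrow> 'b \<Rightarrow> complex"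
  assume "\<forall>k<n. \<phi> k \<in> characters Y"
  then have \<phi>: "\<phi> k \<in> characters Y" if "k < n" for k
    using that by blast
  define \<psi> where "\<psi> y = (\<Sum>k<n. \<alpha> k * \<phi> k y)" for y
  have hc: "h x \<in> carrier Y" if "x \<in> carrier X" for x
    using h that by (simp add: alg_hom_def)
  have \<psi>_scale: "\<psi> (h (scale X c x)) = c * \<psi> (h x)" if "x \<in> carrier X" for c x
    using h that \<phi> hc[OF that] by (simp add: alg_hom_def \<psi>_def character_sum_scale)
  have dual: "dual_norm X (\<lambda>x. \<psi> (h x)) \<le> ennreal C * dual_norm Y \<psi>"
    unfolding dual_norm_def[of X]
  proof (rule SUP_least, clarify)
    fix x assume x: "x \<in> carrier X" "nrm X x \<le> 1"
    \<comment> \<open>Since \<open>nrm Y (h x) \<le> C\<close> on the unit ball, division by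
      \<open>C\<close> moves the image into the unit ball of \<open>Y\<close>.\<close>
    let ?y = "scale X (of_real (1 / C)) x"
    have y: "?y \<in> carrier X" "nrm X ?y = (1 / C) * nrm X x"
      using X x C(1) by (auto simp: normed_scale_def norm_divide simp del: of_real_divide)
    have "nrm Y (h ?y) \<le> 1"
      using C(2)[OF y(1)] y(2) x(2) C(1) by simp
    then have "ennreal (cmod (\<psi> (h ?y))) \<le> dual_norm Y \<psi>"
      by (intro le_dual_norm hc y)
    moreover have "cmod (\<psi> (h x)) = C * cmod (\<psi> (h ?y))"
      using C(1) x(1) by (simp add: \<psi>_scale norm_mult norm_divide)
    ultimately show "ennreal (cmod (\<psi> (h x))) \<le> ennreal C * dual_norm Y \<psi>"
      using C(1) by (simp add: ennreal_mult mult_left_mono)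
  qed
  have "ennreal (cmod (\<psi> (h b))) \<le> ennreal \<beta> * dual_norm X (\<lambda>x. \<psi> (h x))"
  \<comment> \<open>A substitute for vanishing pullbacks must itself be a character of
    \<open>X\<close>. If there is none, all pullbacks vanish at \<open>b\<close> and the left side
    is 0.\<close>
  proof (cases "characters X = {}")
    case True
    then have "\<phi> k (h b) = 0" if "k < n" for k
      using alg_hom_pullback[OF h \<phi>[OF that] b] by auto
    then have "\<psi> (h b) = 0"
      by (simp add: \<psi>_def)
    then show ?thesis
      by simp
  next
    case False
    then obtain \<phi>0 where \<phi>0: "\<phi>0 \<in> characters X"
      by blast
    \<comment> \<open>A pulled back character that vanishes is replaced by \<open>\<phi>0\<close> with coefficient \<open>0\<close>.\<close>
    define P where "P k \<longleftrightarrow> (\<exists>x\<in>carrier X. \<phi> k (h x) \<noteq> 0)" for k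
    define \<phi>' where "\<phi>' k = (if P k then \<lambda>x. \<phi> k (h x) else \<phi>0)" for k
    define \<alpha>' where "\<alpha>' k = (if P k then \<alpha> k else 0)" for k
    have \<phi>': "\<phi>' k \<in> characters X" if "k < n" for k
      using alg_hom_pullback[OF h \<phi>[OF that]] \<phi>0 by (auto simp: \<phi>'_def P_def)
    have eq: "(\<Sum>k<n. \<alpha>' k * \<phi>' k x) = \<psi> (h x)" if "x \<in> carrier X" for x
      unfolding \<psi>_def using that by (intro sum.cong refl) (auto simp: \<phi>'_def \<alpha>'_def P_def)
    have "ennreal (cmod (\<Sum>k<n. \<alpha>' k * \<phi>' k b))
        \<le> ennreal \<beta> * dual_norm X (\<lambda>x. \<Sum>k<n. \<alpha>' k * \<phi>' k x)"
      using \<beta> \<phi>' unfolding bse_bound_def by blast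
    also have "dual_norm X (\<lambda>x. \<Sum>k<n. \<alpha>' k * \<phi>' k x) = dual_norm X (\<lambda>x. \<psi> (h x))"
      unfolding dual_norm_def by (intro SUP_cong) (auto simp: eq)
    finally show ?thesis
      by (simp add: eq b)
  qed
  also have "\<dots> \<le> ennreal \<beta> * (ennreal C * dual_norm Y \<psi>)"
    by (intro mult_left_mono dual) auto
  also have "\<dots> = ennreal (C * \<beta>) * dual_norm Y \<psi>"
    using C(1) \<beta> by (simp add: bse_bound_def ennreal_mult mult_ac)
  finally show "ennreal (cmod (\<Sum>k<n. \<alpha> k * \<phi> k (h b)))
      \<le> ennreal (C * \<beta>) * dual_norm Y (\<lambda>x. \<Sum>k<n. \<alpha> k * \<phi> k x)"
    by (simp add: \<psi>_def[abs_def])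
qed

lemma bse_norm_hom:
  assumes X: "normed_scale X" and h: "alg_hom X Y h"
    and C: "0 < C" "\<And>x. x \<in> carrier X \<Longrightarrow> nrm Y (h x) \<le> C * nrm X x"
    and b: "b \<in> carrier X"
  shows "bse_norm Y (h b) \<le> C * bse_norm X b"
proof -
  \<comment> \<open>Dividing by \<open>C\<close> leaves a bare infimum on the right, so it suffices
    to compare with each admissible \<beta>.\<close>
  have "bse_norm Y (h b) / C \<le> bse_norm X b"
    unfolding bse_norm_eq[of X]
  proof (rule cInf_greatest)
    show "{\<beta>. bse_bound X b \<beta>} \<noteq> {}"
      using bse_bound_nrm[OF X b, of "max (nrm X b) 1"] by fastforce
  next
    fix \<beta> assume "\<beta> \<in> {\<beta>. bse_bound X b \<beta>}"
    then have "bse_bound Y (h b) (C * \<beta>)"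
      using bse_bound_hom[OF X h C b] by blast
    moreover have "bdd_below {\<beta>. bse_bound Y (h b) \<beta>}"
      by (rule bdd_belowI[of _ 0]) (auto simp: bse_bound_def)
    ultimately have "bse_norm Y (h b) \<le> C * \<beta>"
      unfolding bse_norm_eq by (intro cInf_lower) auto
    then show "bse_norm Y (h b) / C \<le> \<beta>"
      using C(1) by (simp add: field_simps)
  qed
  then show ?thesis
    using C(1) by (simp add: field_simps)
qed

section \<open>Haar measure and reflection\<close>

lemma haar_sets: "normalized_haar \<mu> \<Longrightarrow> sets \<mu> = sets borel"
  unfolding normalized_haar_def by (elim conjE)

lemma haar_UNIV: "normalized_haar \<mu> \<Longrightarrow> emeasure \<mu> UNIV = 1"
  unfolding normalized_haar_def by (elim conjE)

lemma haar_translate: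
  assumes "normalized_haar \<mu>" and B: "B \<in> sets borel"
  shows "emeasure \<mu> ((+) x ` B) = emeasure \<mu> B"
proof -
  have "\<forall>x. \<forall>B\<in>sets borel. emeasure \<mu> ((+) x ` B) = emeasure \<mu> B"
    using assms(1) unfolding normalized_haar_def by (elim conjE)
  with B show ?thesis
    by blast
qed

lemma haar_outer:
  assumes "normalized_haar \<mu>" and B: "B \<in> sets borel"
  shows "emeasure \<mu> B = (INF U\<in>{U. open U \<and> B \<subseteq> U}. emeasure \<mu> U)"
proof -
  have "\<forall>B\<in>sets borel. emeasure \<mu> B = (INF U\<in>{U. open U \<and> B \<subseteq> U}. emeasure \<mu> U)"
    using assms(1) unfolding normalized_haar_def by (elim conjE)
  then show ?thesis
    using B by (rule bspec)
qed

lemma haar_inner: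
  assumes "normalized_haar \<mu>" and U: "open U"
  shows "emeasure \<mu> U = (SUP K\<in>{K. compact K \<and> K \<subseteq> U}. emeasure \<mu> K)"
proof -
  have "\<forall>U. open U \<longrightarrow> emeasure \<mu> U = (SUP K\<in>{K. compact K \<and> K \<subseteq> U}. emeasure \<mu> K)"
    using assms(1) unfolding normalized_haar_def by (elim conjE)
  from this[THEN spec] show ?thesis
    using U by (rule mp)
qed

lemma haar_space: "normalized_haar \<mu> \<Longrightarrow> space \<mu> = UNIV"
  using haar_sets[THEN sets_eq_imp_space_eq] by simp

lemma translate_open:
  fixes U :: "'g::topological_ab_group_add set"
  assumes "open U"
  shows "open ((\<lambda>x. g - x) -` U)"
  using assms by (intro open_vimage) (auto intro!: continuous_intros)

text \<open>
  If \<open>x\<close> is close to \<open>d\<^sub>i\<close>, then \<open>x - y \<in> K\<close> implies \<open>d\<^sub>i - y \<in> U\<close>.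
  Averaging over a finite partition in \<open>x\<close> and integrating over \<open>y\<close> replaces a Fubini argument on
  \<open>G \<times> G\<close>, whose Borel sets need not be generated by rectangles.
\<close>

lemma haar_compact_le_reflected_open:
  fixes \<mu> :: "'g::{topological_ab_group_add, t2_space} measure"
  assumes G: "compact (UNIV :: 'g set)" and \<mu>: "normalized_haar \<mu>"
    and K: "compact K" and U: "open U" and KU: "K \<subseteq> U"
  shows "emeasure \<mu> K \<le> emeasure \<mu> (uminus -` U)"
proof -
  note sets = haar_sets[OF \<mu>] and one = haar_UNIV[OF \<mu>] and trans = haar_translate[OF \<mu>]
    and sp = haar_space[OF \<mu>]
  have Km: "K \<in> sets borel"
    using K by (simp add: borel_closed compact_imp_closed)
  have refl: "open (uminus -` U)"
    using translate_open[OF U, of 0] by simp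
  \<comment> \<open>\<open>W\<close> is the preimage of \<open>U\<close> under addition. The tube
    lemma turns \<open>K \<subseteq> U\<close> into a neighbourhood \<open>V\<close> of 0 with
    \<open>V + K \<subseteq> U\<close>.\<close>
  define W where "W = (\<lambda>z. fst z + snd z) -` U"
  have "open W"
    unfolding W_def by (intro open_vimage U continuous_intros)
  moreover have "{0} \<times> K \<subseteq> W"
    using KU by (auto simp: W_def)
  ultimately have "\<exists>V. 0 \<in> V \<and> open V \<and> V \<times> K \<subseteq> W"
    by (rule Elementary_Topology.tube_lemma[OF K])
  then obtain V where V: "0 \<in> V" "open V" "V \<times> K \<subseteq> W"
    by (elim exE conjE)
  have VK: "v + k \<in> U" if "v \<in> V" "k \<in> K" for v k
    using V(3) that by (auto simp: W_def)
  have "open ((\<lambda>x. g - x) -` V)" for g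
    using V(2) by (rule translate_open)
  moreover have "UNIV \<subseteq> (\<Union>g\<in>UNIV. (\<lambda>x. g - x) -` V)"
    using V(1) by auto
  ultimately obtain D where D: "finite D" "UNIV \<subseteq> (\<Union>g\<in>D. (\<lambda>x. g - x) -` V)"
    by (rule compactE_image[OF G])
  obtain d m where d: "bij_betw d {..<m::nat} D"
    using bij_betw_from_nat_into_finite[OF D(1)] by (rule that)
  \<comment> \<open>\<open>A i\<close> is the set \<open>d i - V\<close>; by compactness these cover
    the group. Making them disjoint gives a Borel partition of total mass 1, whose masses serve as
    weights.\<close>
  define A where "A i = (\<lambda>x. d i - x) -` V" for i
  define E where "E = disjointed A"
  have "A i \<in> sets borel" for i
    unfolding A_def using translate_open[OF V(2)] by simp
  then have Em: "E i \<in> sets \<mu>" for i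
    unfolding E_def using sets.range_disjointed_sets[of A \<mu>] by (auto simp: sets)
  have "(\<Union>i\<in>{0..<m}. E i) = (\<Union>i\<in>{0..<m}. A i)"
    unfolding E_def by (rule finite_UN_disjointed_eq)
  moreover have "(\<Union>i\<in>{0..<m}. A i) = UNIV"
    using D(2) d unfolding A_def bij_betw_def by (force simp: atLeast0LessThan)
  ultimately have cover: "(\<Union>i<m. E i) = UNIV"
    by (simp add: atLeast0LessThan)
  have "disjoint_family E"
    unfolding E_def by (rule disjoint_family_disjointed)
  then have sum1: "(\<Sum>i<m. emeasure \<mu> (E i)) = 1"
    using sum_emeasure[of E "{..<m}" \<mu>] Em cover one
    by (auto simp: disjoint_family_on_def)
  \<comment> \<open>If \<open>y + k\<close> lies in \<open>E i\<close>, then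
    \<open>d i - y = (d i - (y + k)) + k\<close> lies in \<open>V + K\<close>, hence in
    \<open>U\<close>. So the cells counted on the right cover \<open>y + K\<close>, which has the
    mass of \<open>K\<close>.\<close>
  have pw: "emeasure \<mu> K \<le> (\<Sum>i<m. emeasure \<mu> (E i) * indicator ((\<lambda>y. d i - y) -` U) y)" for y
  proof -
    let ?I = "{i \<in> {..<m}. d i - y \<in> U}"
    have "(+) y ` K \<subseteq> (\<Union>i\<in>?I. E i)"
    proof clarify
      fix k assume k: "k \<in> K"
      obtain i where i: "i < m" "y + k \<in> E i"
        using UNIV_I[of "y + k"] unfolding cover[symmetric] by auto
      then have "d i - (y + k) \<in> V"
        using disjointed_subset[of A i] by (auto simp: E_def A_def)
      from VK[OF this k] have "d i - y \<in> U"
        by (simp add: algebra_simps)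
      with i show "y + k \<in> (\<Union>i\<in>?I. E i)"
        by blast
    qed
    then have "emeasure \<mu> ((+) y ` K) \<le> emeasure \<mu> (\<Union>i\<in>?I. E i)"
      using Em by (intro emeasure_mono) auto
    also have "\<dots> \<le> (\<Sum>i\<in>?I. emeasure \<mu> (E i))"
      using Em by (intro emeasure_subadditive_finite) auto
    also have "\<dots> = (\<Sum>i<m. emeasure \<mu> (E i) * indicator ((\<lambda>y. d i - y) -` U) y)"
      by (intro sum.mono_neutral_cong_left) (auto simp: indicator_def)
    finally show ?thesis
      by (simp add: trans Km)
  qed
  have meas: "(\<lambda>y. d i - y) -` U \<in> sets \<mu>" for i
    using translate_open[OF U] by (simp add: sets)
  \<comment> \<open>The set of \<open>y\<close> with \<open>d i - y\<close> in \<open>U\<close> is a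
    translate of the reflection of \<open>U\<close>, so its mass does not depend on
    \<open>i\<close>.\<close>
  have shift: "emeasure \<mu> ((\<lambda>y. d i - y) -` U) = emeasure \<mu> (uminus -` U)" for i
  proof -
    have "(\<lambda>y. d i - y) -` U = (+) (d i) ` (uminus -` U)"
      by (auto simp: image_iff intro!: bexI[of _ "x - d i" for x])
    then show ?thesis
      using trans[of "uminus -` U" "d i"] refl by simp
  qed
  have "emeasure \<mu> K = (\<integral>\<^sup>+y. emeasure \<mu> K \<partial>\<mu>)"
    using one by (simp add: sp)
  also have "\<dots> \<le> (\<integral>\<^sup>+y. (\<Sum>i<m. emeasure \<mu> (E i) * indicator ((\<lambda>y. d i - y) -` U) y) \<partial>\<mu>)"
    by (intro nn_integral_mono pw)
  also have "\<dots> = (\<Sum>i<m. emeasure \<mu> (E i) * emeasure \<mu> ((\<lambda>y. d i - y) -` U))"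
    using meas by (subst nn_integral_sum) (auto simp: nn_integral_cmult_indicator)
  also have "\<dots> = emeasure \<mu> (uminus -` U)"
    by (simp add: shift sum1 flip: sum_distrib_right)
  finally show ?thesis .
qed

text \<open>The preceding inequality, applied to compact subsets of the reflection of an open
  \<open>U\<close>, and inner regularity show that reflection does not increase the mass of
  \<open>U\<close>. Outer regularity of \<open>N\<close> then lets that mass tend to 0.\<close>

lemma haar_reflected_null:
  fixes \<mu> :: "'g::{topological_ab_group_add, t2_space} measure"
  assumes G: "compact (UNIV :: 'g set)" and \<mu>: "normalized_haar \<mu>"
    and N: "N \<in> sets borel" "emeasure \<mu> N = 0"
  shows "emeasure \<mu> (uminus -` N) = 0"
proof -
  note sets = haar_sets[OF \<mu>] and outer = haar_outer[OF \<mu> N(1)] and inner = haar_inner[OF \<mu>]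
  have "emeasure \<mu> (uminus -` N) \<le> emeasure \<mu> U" if U: "open U" "N \<subseteq> U" for U
  proof -
    have rU: "open (uminus -` U)"
      using translate_open[OF U(1), of 0] by simp
    have "emeasure \<mu> (uminus -` N) \<le> emeasure \<mu> (uminus -` U)"
      using U(2) rU by (intro emeasure_mono) (auto simp: sets)
    also have "\<dots> \<le> emeasure \<mu> U"
      unfolding inner[OF rU]
    proof (rule SUP_least, clarify)
      fix K assume K: "compact K" "K \<subseteq> uminus -` U"
      have "uminus -` uminus -` U = U"
        by auto
      then show "emeasure \<mu> K \<le> emeasure \<mu> U"
        using haar_compact_le_reflected_open[OF G \<mu> K(1) rU K(2)] by simp
    qed
    finally show ?thesis .
  qed
  then have "emeasure \<mu> (uminus -` N) \<le> emeasure \<mu> N"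
    unfolding outer by (intro INF_greatest) auto
  then show ?thesis
    using N by simp
qed

text \<open>Needed for the second factor of a convolution. The exceptional set becomes
  \<open>x - N\<close>, a translate of the reflected null set.\<close>

lemma haar_AE_reflect:
  fixes \<mu> :: "'g::{topological_ab_group_add, t2_space} measure"
  assumes G: "compact (UNIV :: 'g set)" and \<mu>: "normalized_haar \<mu>"
    and P: "AE y in \<mu>. P y"
  shows "AE y in \<mu>. P (- y + x)"
proof -
  note sets = haar_sets[OF \<mu>] and trans = haar_translate[OF \<mu>] and sp = haar_space[OF \<mu>]
  obtain N where N: "{y \<in> space \<mu>. \<not> P y} \<subseteq> N" "emeasure \<mu> N = 0" "N \<in> sets \<mu>"
    using P by (rule AE_E)
  have cont: "continuous_on UNIV (uminus :: 'g \<Rightarrow> 'g)"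
    by (intro continuous_intros)
  have m: "uminus -` N \<in> sets borel"
    using measurable_sets[OF borel_measurable_continuous_onI[OF cont], of N] N(3) sets by simp
  have "(+) x ` (uminus -` N) \<in> null_sets \<mu>"
  proof
    have "(+) x ` (uminus -` N) = (\<lambda>y. x - y) -` N"
      by (auto simp: image_iff intro!: bexI[of _ "z - x" for z])
    moreover have "continuous_on UNIV (\<lambda>y. x - y)"
      by (intro continuous_intros)
    then have "(\<lambda>y. x - y) -` N \<in> sets borel"
      using measurable_sets[OF borel_measurable_continuous_onI, of "\<lambda>y. x - y" N] N(3) sets by simp
    ultimately show "(+) x ` (uminus -` N) \<in> sets \<mu>"
      by (simp add: sets)
    show "emeasure \<mu> ((+) x ` (uminus -` N)) = 0"
      using haar_reflected_null[OF G \<mu>] N m trans sets by simp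
  qed
  then show ?thesis
  proof (rule AE_I')
    show "{y \<in> space \<mu>. \<not> P (- y + x)} \<subseteq> (+) x ` (uminus -` N)"
    proof clarify
      fix y assume "\<not> P (- y + x)"
      then have "- y + x \<in> N"
        using N(1) by (auto simp: sp)
      then show "y \<in> (+) x ` (uminus -` N)"
        by (auto simp: image_iff intro!: bexI[of _ "y - x"])
    qed
  qed
qed

section \<open>Constant functions\<close>

lemma lp_class_cong:
  assumes "AE x in \<mu>. f x = g x"
  shows "lp_class \<mu> p f = lp_class \<mu> p g"
proof -
  have "(AE x in \<mu>. f x = h x) \<longleftrightarrow> (AE x in \<mu>. g x = h x)" for h
    using assms by (auto elim: AE_mp)
  then show ?thesis
    by (simp add: lp_class_def)
qed

lemma rep_lp_class:
  assumes "f \<in> lp_fun \<mu> p"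
  shows "rep (lp_class \<mu> p f) \<in> lp_fun \<mu> p" "AE x in \<mu>. rep (lp_class \<mu> p f) x = f x"
proof -
  have "f \<in> lp_class \<mu> p f"
    using assms by (simp add: lp_class_def)
  then have "rep (lp_class \<mu> p f) \<in> lp_class \<mu> p f"
    by (auto simp: rep_def some_in_eq)
  then show "rep (lp_class \<mu> p f) \<in> lp_fun \<mu> p" "AE x in \<mu>. rep (lp_class \<mu> p f) x = f x"
    by (auto simp: lp_class_def eq_commute)
qed

lemma normed_scale_type_algebra:
  "normed_scale (type_algebra :: 'a::comm_complex_banach_algebra calgebra)"
  by (simp add: normed_scale_def type_algebra_def norm_scaleC)

context
  fixes \<mu> :: "'g::{topological_ab_group_add, t2_space} measure" and p :: real
    and const :: "'a::{comm_complex_banach_algebra, second_countable_topology} \<Rightarrow> ('g \<Rightarrow> 'a) set"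
  defines "const \<equiv> \<lambda>a. lp_class \<mu> p (\<lambda>_. a)"
  assumes G: "compact (UNIV :: 'g set)" and \<mu>: "normalized_haar \<mu>" and p: "1 \<le> p"
begin

lemma prob_space_haar: "prob_space \<mu>"
  using haar_UNIV[OF \<mu>] haar_space[OF \<mu>] by (intro prob_spaceI) simp

lemma const_eq: "lp_class \<mu> p (\<lambda>_. a) = const a"
  by (simp add: const_def)

lemma const_lp_fun: "(\<lambda>_. a) \<in> lp_fun \<mu> p"
proof -
  interpret prob_space \<mu> by (rule prob_space_haar)
  show ?thesis
    by (simp add: lp_fun_def emeasure_space_1 ennreal_mult_less_top)
qed

lemma rep_const: "rep (const a) \<in> borel_measurable \<mu>" "AE x in \<mu>. rep (const a) x = a"
  using rep_lp_class[OF const_lp_fun[of a]] measurable_cong_sets[OF haar_sets[OF \<mu>], of borel borel]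
  by (auto simp: const_def lp_fun_def)

text \<open>The chosen representatives are constant only almost everywhere. For the second one this
  is needed at \<open>- y + x\<close>, where \<open>haar_AE_reflect\<close> enters; total mass 1
  then gives the exact product at every \<open>x\<close>.\<close>

lemma convolution_const: "convolution \<mu> (rep (const a)) (rep (const b)) x = a * b"
proof -
  interpret prob_space \<mu> by (rule prob_space_haar)
  note [measurable_cong] = haar_sets[OF \<mu>]
  have "continuous_on UNIV (\<lambda>y::'g. - y + x)"
    by (intro continuous_intros)
  then have [measurable]: "(\<lambda>y. - y + x) \<in> \<mu> \<rightarrow>\<^sub>M \<mu>"
    using borel_measurable_continuous_onI by measurable
  note [measurable] = rep_const(1)
  have "convolution \<mu> (rep (const a)) (rep (const b)) x = (\<integral>y. a * b \<partial>\<mu>)"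
    unfolding convolution_def
  proof (rule integral_cong_AE)
    show "AE y in \<mu>. rep (const a) y * rep (const b) (- y + x) = a * b"
      using rep_const(2)[of a] haar_AE_reflect[OF G \<mu> rep_const(2)[of b], of x] by eventually_elim simp
  qed measurable
  then show ?thesis
    by (simp add: prob_space)
qed

lemma alg_hom_const: "alg_hom type_algebra (lp_algebra \<mu> p) const"
proof -
  have "const a \<in> lp_class \<mu> p ` lp_fun \<mu> p" for a
    using const_lp_fun[of a] by (simp add: const_def)
  moreover have "lp_class \<mu> p (\<lambda>x. rep (const a) x + rep (const b) x) = const (a + b)" for a b
    unfolding const_eq[symmetric, of "a + b"] 
    by (rule lp_class_cong, use rep_const(2)[of a] rep_const(2)[of b] in eventually_elim) simp
  moreover have "lp_class \<mu> p (\<lambda>x. scaleC c (rep (const a) x)) = const (scaleC c a)" for a c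
    unfolding const_eq[symmetric, of "scaleC c a"] 
    by (rule lp_class_cong, use rep_const(2)[of a] in eventually_elim) simp
  moreover have "lp_class \<mu> p (convolution \<mu> (rep (const a)) (rep (const b))) = const (a * b)" for a b
    unfolding const_eq[symmetric, of "a * b"] by (intro lp_class_cong) (simp add: convolution_const)
  ultimately show ?thesis
    by (simp add: alg_hom_def type_algebra_def lp_algebra_def)
qed

lemma nrm_const: "nrm (lp_algebra \<mu> p) (const a) = norm a"
proof -
  interpret prob_space \<mu> by (rule prob_space_haar)
  note [measurable] = rep_const(1)
  have "(\<integral>x. norm (rep (const a) x) powr p \<partial>\<mu>) = (\<integral>x. norm a powr p \<partial>\<mu>)"
  proof (rule integral_cong_AE)
    show "AE x in \<mu>. norm (rep (const a) x) powr p = norm a powr p"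
      using rep_const(2)[of a] by eventually_elim simp
  qed measurable
  then show ?thesis
    using p by (simp add: lp_algebra_def prob_space powr_powr)
qed

text \<open>The embedding is isometric, so the same constant \<open>K\<close> serves for the
  coefficient algebra.\<close>

lemma bse_norm_algebra_coefficients:
  assumes "bse_norm_algebra (lp_algebra \<mu> p :: ('g \<Rightarrow> 'a) set calgebra)"
  shows "bse_norm_algebra (type_algebra :: 'a calgebra)"
proof -
  let ?L = "lp_algebra \<mu> p :: ('g \<Rightarrow> 'a) set calgebra"
  let ?A = "type_algebra :: 'a calgebra"
  obtain K where K: "K > 0" "\<And>b. b \<in> carrier ?L \<Longrightarrow> nrm ?L b \<le> K * bse_norm ?L b"
    using assms by (auto simp: bse_norm_algebra_def)
  have "nrm ?A a \<le> K * bse_norm ?A a" for a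
  proof -
    have "nrm ?A a = nrm ?L (const a)"
      by (simp add: nrm_const type_algebra_def)
    also have "\<dots> \<le> K * bse_norm ?L (const a)"
      using alg_hom_const by (intro K) (auto simp: alg_hom_def type_algebra_def)
    also have "bse_norm ?L (const a) \<le> 1 * bse_norm ?A a"
      by (rule bse_norm_hom[OF normed_scale_type_algebra alg_hom_const])
        (auto simp: nrm_const type_algebra_def)
    finally show ?thesis
      using K(1) by simp
  qed
  then show ?thesis
    using K(1) by (auto simp: bse_norm_algebra_def)
qed

end

section \<open>Characters of finite abelian groups\<close>

text \<open>The value 1 at 0 excludes the zero function. Modulus 1 is not imposed, since on a finite
  group it follows.\<close>

definition group_characters :: "('g::ab_group_add \<Rightarrow> complex) set" where
  "group_characters = {\<xi>. \<xi> 0 = 1 \<and> (\<forall>x y. \<xi> (x + y) = \<xi> x * \<xi> y)}"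

text \<open>Translation by \<open>g\<close> permutes the group but adds \<open>card UNIV\<close>
  copies of \<open>g\<close> to the sum of all elements. Multiples are written as sums of equal
  terms.\<close>

lemma sum_card_UNIV_eq_0:
  fixes g :: "'g::ab_group_add"
  assumes "finite (UNIV :: 'g set)"
  shows "(\<Sum>i<card (UNIV :: 'g set). g) = 0"
proof -
  obtain e where e: "bij_betw e {..<card (UNIV :: 'g set)} (UNIV :: 'g set)"
    using bij_betw_from_nat_into_finite[OF assms] by (rule that)
  have "(\<Sum>y\<in>UNIV. y) = (\<Sum>y\<in>UNIV. g + y)"
    by (rule sum.reindex_bij_witness[of _ "\<lambda>y. g + y" "\<lambda>y. y - g"]) auto
  also have "\<dots> = (\<Sum>y\<in>(UNIV :: 'g set). g) + (\<Sum>y\<in>UNIV. y)"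
    by (rule sum.distrib)
  finally have "(\<Sum>y\<in>(UNIV :: 'g set). g) = 0"
    by simp
  then show ?thesis
    using sum.reindex_bij_betw[OF e, of "\<lambda>_. g"] by simp
qed

text \<open>There are only \<open>k < n\<close> roots of order \<open>k\<close>, so some
  \<open>n\<close>-th root \<open>w\<close> has \<open>w ^ k \<noteq> 1\<close>. Multiplication by
  \<open>w\<close> permutes the roots and multiplies the sum by \<open>w ^ k\<close>.\<close>

lemma sum_powers_roots_unity:
  assumes "0 < k" "k < n"
  shows "(\<Sum>c | c ^ n = 1. c ^ k) = (0 :: complex)"
proof -
  have n: "n > 0" "k > 0"
    using assms by auto
  have "\<exists>w::complex. w ^ n = 1 \<and> w ^ k \<noteq> 1"
  proof (rule ccontr)
    assume "\<not> ?thesis"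
    then have "{w::complex. w ^ n = 1} \<subseteq> {w. w ^ k = 1}"
      by blast
    then have "card {w::complex. w ^ n = 1} \<le> card {w::complex. w ^ k = 1}"
      using n by (intro card_mono finite_roots_unity) auto
    then show False
      using assms n by (simp add: card_roots_unity_eq)
  qed
  then obtain w :: complex where w: "w ^ n = 1" "w ^ k \<noteq> 1"
    by blast
  then have "w \<noteq> 0"
    using n by (auto simp: power_0_left)
  then have "(\<Sum>c | c ^ n = 1. c ^ k) = (\<Sum>c | c ^ n = 1. (w * c) ^ k)"
    using w by (intro sum.reindex_bij_witness[of _ "\<lambda>c. w * c" "\<lambda>c. c / w"])
      (auto simp: power_mult_distrib power_divide)
  also have "\<dots> = w ^ k * (\<Sum>c | c ^ n = 1. c ^ k)"
    by (simp add: power_mult_distrib sum_distrib_left)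
  finally show ?thesis
    using w(2) by simp
qed

text \<open>
  A function which is a simultaneous eigenfunction of all translations is a multiple of a character.
  The invariant \<open>\<Sum>k<n. u (y + k x) = 0\<close> survives linear combinations of translates of \<open>u\<close> and
  excludes the eigenvalue \<open>1\<close> for the translation by \<open>x\<close>.
\<close>

lemma ex_eigenfunction:
  fixes x :: "'g::ab_group_add"
  defines "n \<equiv> card (UNIV :: 'g set)"
  assumes fin: "finite (UNIV :: 'g set)" and x: "x \<noteq> 0" and S: "finite S"
  shows "\<exists>u \<xi>. (\<exists>y. u y \<noteq> 0) \<and> (\<forall>s\<in>S. \<forall>y. u (y + s) = \<xi> s * (u y :: complex)) \<and>
    (\<forall>y. (\<Sum>k<n. u (y + (\<Sum>i<k. x))) = 0)"
  using S
proof induction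
  case empty
  \<comment> \<open>A point mass minus its translate: the sum along the multiples of
    \<open>x\<close> telescopes to 0 because \<open>n x = 0\<close>, and the value at 0 is 1 because
    \<open>x \<noteq> 0\<close>.\<close>
  let ?v = "\<lambda>y::'g. if y = 0 then 1 else 0 :: complex"
  let ?u = "\<lambda>y. ?v y - ?v (y + x)"
  have nx: "(\<Sum>i<n. x) = 0"
    unfolding n_def by (rule sum_card_UNIV_eq_0[OF fin])
  have "(\<Sum>k<n. ?u (y + (\<Sum>i<k. x))) = 0" for y
    using sum_lessThan_telescope'[of "\<lambda>k. ?v (y + (\<Sum>i<k. x))" n] nx by (simp add: add_ac)
  moreover have "?u 0 \<noteq> 0"
    using x by simp
  ultimately show ?case
    by (intro exI[of _ ?u]) auto
next
  case (insert g S)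
  from insert.IH obtain u \<xi> z where u: "u z \<noteq> 0" "\<And>s y. s \<in> S \<Longrightarrow> u (y + s) = \<xi> s * u y"
    "\<And>y. (\<Sum>k<n. u (y + (\<Sum>i<k. x))) = (0::complex)"
    by metis
  \<comment> \<open>For \<open>c ^ n = 1\<close>, this is \<open>n\<close> times the projection of
    \<open>u\<close> onto the eigenspace of translation by \<open>g\<close> with eigenvalue
    \<open>1 / c\<close>.\<close>
  define w where "w c y = (\<Sum>k<n. c ^ k * u (y + (\<Sum>i<k. g)))" for c y
  have n: "n > 0"
    using fin by (simp add: n_def card_gt_0_iff)
  have ng: "(\<Sum>i<n. g) = 0"
    unfolding n_def by (rule sum_card_UNIV_eq_0[OF fin])
  \<comment> \<open>Summed over all \<open>n\<close>-th roots of unity, only the term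
    \<open>k = 0\<close> survives and gives \<open>n * u z\<close>, so some projection is nonzero at
    \<open>z\<close>.\<close>
  have "\<exists>c. c ^ n = 1 \<and> w c z \<noteq> 0"
  proof (rule ccontr)
    assume "\<not> ?thesis"
    then have "0 = (\<Sum>c | c ^ n = 1. w c z)"
      by simp
    also have "\<dots> = (\<Sum>k<n. (\<Sum>c | c ^ n = 1. c ^ k) * u (z + (\<Sum>i<k. g)))"
      unfolding w_def by (subst sum.swap) (simp add: sum_distrib_right)
    also have "\<dots> = (\<Sum>k\<in>{0}. (\<Sum>c | c ^ n = 1. c ^ k) * u (z + (\<Sum>i<k. g)))"
      using n by (intro sum.mono_neutral_right) (auto simp: sum_powers_roots_unity)
    also have "\<dots> = of_nat n * u z"
      using n by (simp add: card_roots_unity_eq)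
    finally show False
      using n u(1) by simp
  qed
  then obtain c where c: "c ^ n = 1" "w c z \<noteq> 0"
    by blast
  then have c0: "c \<noteq> 0"
    using n by (auto simp: power_0_left)
  have g: "w c (y + g) = (1 / c) * w c y" for y
  proof -
    \<comment> \<open>Shifting the index exchanges the first term for the \<open>n\<close>-th one;
      they agree since \<open>c ^ n = 1\<close> and \<open>n g = 0\<close>.\<close>
    let ?t = "\<lambda>k. c ^ k * u (y + (\<Sum>i<k. g))"
    have "c * w c (y + g) = (\<Sum>k<n. ?t (Suc k))"
      by (simp add: w_def sum_distrib_left add_ac mult_ac)
    also have "\<dots> + ?t 0 = (\<Sum>k<n. ?t k) + ?t n"
      using sum.lessThan_Suc_shift[of ?t n] sum.lessThan_Suc[of ?t n] by (simp add: add_ac)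
    finally have "c * w c (y + g) = w c y"
      using c(1) ng by (simp add: w_def)
    then show ?thesis
      using c0 by (simp add: field_simps)
  qed
  \<comment> \<open>Translations commute, so the old eigenvalues, and below also the invariant, pass
    to \<open>w c\<close>.\<close>
  have s: "w c (y + s) = \<xi> s * w c y" if "s \<in> S" for s y
  proof -
    have "u (y + s + t) = \<xi> s * u (y + t)" for t
      using u(2)[OF that, of "y + t"] by (simp add: add_ac)
    then show ?thesis
      by (simp add: w_def sum_distrib_left mult_ac)
  qed
  have "(\<Sum>k<n. w c (y + (\<Sum>i<k. x))) = 0" for y
  proof -
    have "(\<Sum>k<n. w c (y + (\<Sum>i<k. x)))
        = (\<Sum>j<n. c ^ j * (\<Sum>k<n. u ((y + (\<Sum>i<j. g)) + (\<Sum>i<k. x))))"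
      unfolding w_def by (subst sum.swap) (simp add: sum_distrib_left add_ac)
    then show ?thesis
      by (simp add: u(3))
  qed
  then show ?case
    using c(2) g s insert.hyps
    by (intro exI[of _ "w c"] exI[of _ "\<xi>(g := 1 / c)"]) auto
qed

text \<open>Taking \<open>S\<close> to be the whole group gives \<open>u s = \<xi> s * u 0\<close>,
  which forces \<xi> to be multiplicative. If \<open>\<xi> x = 1\<close>, then \<open>u\<close> is
  constant on the multiples of \<open>x\<close> and the invariant reads
  \<open>n * u 0 = 0\<close>.\<close>

lemma group_characters_separate:
  fixes x :: "'g::ab_group_add"
  assumes fin: "finite (UNIV :: 'g set)" and x: "x \<noteq> 0"
  obtains \<xi> where "\<xi> \<in> group_characters" "\<xi> x \<noteq> 1"
proof -
  let ?n = "card (UNIV :: 'g set)"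
  obtain u \<xi> z where u: "u z \<noteq> 0" "\<And>s y::'g. u (y + s) = \<xi> s * (u y :: complex)"
    "\<And>y. (\<Sum>k<?n. u (y + (\<Sum>i<k. x))) = 0"
    using ex_eigenfunction[OF fin x fin] by (metis UNIV_I)
  have us: "u s = \<xi> s * u 0" for s
    using u(2)[of 0 s] by simp
  have u0: "u 0 \<noteq> 0"
    using us[of z] u(1) by auto
  have "\<xi> (s + t) * u 0 = \<xi> s * \<xi> t * u 0" for s t
    using us[of "s + t", symmetric] u(2)[of s t] us[of s] by (simp add: mult_ac)
  then have "\<xi> \<in> group_characters"
    using u0 us[of 0] by (auto simp: group_characters_def)
  moreover have "\<xi> x \<noteq> 1"
  proof
    assume "\<xi> x = 1"
    then have "u (\<Sum>i<k. x) = u 0" for k :: nat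
      by (induction k) (simp_all add: u(2))
    then have "of_nat ?n * u 0 = 0"
      using u(3)[of 0] by simp
    then show False
      using u0 fin by simp
  qed
  ultimately show ?thesis
    by (rule that)
qed

section \<open>Values and orthogonality of characters\<close>

lemma group_character_minus:
  assumes "\<xi> \<in> group_characters"
  shows "\<xi> (- x) * \<xi> x = 1"
  using assms unfolding group_characters_def
  by (metis (mono_tags, lifting) add.left_inverse mem_Collect_eq)

lemma group_character_diff:
  assumes "\<xi> \<in> group_characters"
  shows "\<xi> (x - y) = \<xi> x * \<xi> (- y)"
proof -
  have "\<xi> (x + - y) = \<xi> x * \<xi> (- y)"
    using assms unfolding group_characters_def by blast
  then show ?thesis
    by simp
qed

lemma group_character_power_card:
  fixes \<xi> :: "'g::ab_group_add \<Rightarrow> complex"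
  assumes "finite (UNIV :: 'g set)" and \<xi>: "\<xi> \<in> group_characters"
  shows "\<xi> x ^ card (UNIV :: 'g set) = 1"
proof -
  have "\<xi> (\<Sum>i<k. x) = \<xi> x ^ k" for k :: nat
    using \<xi> by (induction k) (simp_all add: group_characters_def mult.commute)
  from this[of "card (UNIV :: 'g set)"] show ?thesis
    using \<xi> by (simp add: sum_card_UNIV_eq_0[OF assms(1)] group_characters_def)
qed

lemma norm_group_character:
  fixes \<xi> :: "'g::ab_group_add \<Rightarrow> complex"
  assumes fin: "finite (UNIV :: 'g set)" and "\<xi> \<in> group_characters"
  shows "cmod (\<xi> x) = 1"
proof -
  have "cmod (\<xi> x) ^ card (UNIV :: 'g set) = 1"
    using group_character_power_card[OF assms] by (metis norm_one norm_power)
  then show ?thesis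
    using fin power_eq_imp_eq_base[of "cmod (\<xi> x)" "card (UNIV :: 'g set)" 1]
    by (simp add: card_gt_0_iff)
qed

lemma finite_group_characters:
  assumes fin: "finite (UNIV :: 'g::ab_group_add set)"
  shows "finite (group_characters :: ('g \<Rightarrow> complex) set)"
proof (rule finite_subset)
  show "group_characters \<subseteq> PiE UNIV (\<lambda>_::'g. {c::complex. c ^ card (UNIV :: 'g set) = 1})"
    using group_character_power_card[OF fin] by auto
  show "finite (PiE UNIV (\<lambda>_::'g. {c::complex. c ^ card (UNIV :: 'g set) = 1}))"
    using fin by (intro finite_PiE finite_roots_unity) (auto simp: Suc_le_eq card_gt_0_iff)
qed

text \<open>Multiplication by a character \<psi> with \<open>\<psi> x \<noteq> 1\<close> permutes
  the characters and multiplies the sum by \<open>\<psi> x\<close>.\<close>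

lemma sum_group_characters:
  fixes x :: "'g::ab_group_add"
  assumes fin: "finite (UNIV :: 'g set)"
  shows "(\<Sum>\<xi>\<in>group_characters. \<xi> x) = (if x = 0 then of_nat (card (group_characters :: ('g \<Rightarrow> complex) set)) else 0)"
proof (cases "x = 0")
  case True
  then show ?thesis
    by (simp add: group_characters_def)
next
  case False
  then obtain \<psi> where \<psi>: "\<psi> \<in> group_characters" "\<psi> x \<noteq> 1"
    using group_characters_separate[OF fin] by blast
  have nz: "\<psi> y \<noteq> 0" for y
    using group_character_minus[OF \<psi>(1), of y] by auto
  have "(\<Sum>\<xi>\<in>group_characters. \<xi> x) = (\<Sum>\<xi>\<in>group_characters. \<psi> x * \<xi> x)"
    using \<psi>(1) nz
    by (intro sum.reindex_bij_witness[of _ "\<lambda>\<xi> y. \<psi> y * \<xi> y" "\<lambda>\<xi> y. \<xi> y / \<psi> y"])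
      (auto simp: group_characters_def)
  also have "\<dots> = \<psi> x * (\<Sum>\<xi>\<in>group_characters. \<xi> x)"
    by (simp add: sum_distrib_left)
  finally show ?thesis
    using \<psi>(2) False by simp
qed

section \<open>Finite groups\<close>

lemma scaleC_zero: "scaleC 0 x = (0 :: 'a::comm_complex_banach_algebra)"
  using scaleC_of_real[of 0 x] by simp

lemma scaleC_zero_right: "scaleC c 0 = (0 :: 'a::comm_complex_banach_algebra)"
  using scaleC_add_right[of c 0 "0 :: 'a"] by simp

lemma scaleC_sum_right:
  "scaleC c (\<Sum>i\<in>I. f i) = (\<Sum>i\<in>I. scaleC c (f i :: 'a::comm_complex_banach_algebra))"
  by (induction I rule: infinite_finite_induct) (simp_all add: scaleC_zero_right scaleC_add_right)

lemma scaleC_sum_left: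
  "scaleC (\<Sum>i\<in>I. c i) x = (\<Sum>i\<in>I. scaleC (c i) (x :: 'a::comm_complex_banach_algebra))"
  by (induction I rule: infinite_finite_induct) (simp_all add: scaleC_zero scaleC_add_left)

lemma scaleC_mult_right:
  "x * scaleC c y = scaleC c (x * y :: 'a::comm_complex_banach_algebra)"
  using scaleC_mult_left[of c y x] by (simp add: mult.commute)

section \<open>Normalised Haar measure of a finite group\<close>

lemma sets_borel_finite:
  assumes "finite (UNIV :: 'g::t1_space set)"
  shows "sets (borel :: 'g measure) = UNIV"
proof -
  have "B \<in> sets borel" for B :: "'g set"
    using assms by (intro borel_closed finite_imp_closed) (rule finite_subset[OF subset_UNIV])
  then show ?thesis
    by auto
qed

text \<open>By translation invariance all points have the same mass, and these masses add up to
  1.\<close>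

lemma haar_finite:
  fixes \<mu> :: "'g::{topological_ab_group_add, t2_space} measure"
  assumes fin: "finite (UNIV :: 'g set)" and \<mu>: "normalized_haar \<mu>"
  shows "\<mu> = uniform_count_measure UNIV"
proof (rule measure_eqI_finite)
  show sets: "sets \<mu> = Pow UNIV"
    using haar_sets[OF \<mu>] sets_borel_finite[OF fin] by simp
  show "sets (uniform_count_measure UNIV) = Pow (UNIV :: 'g set)"
    by (simp add: sets_uniform_count_measure)
  let ?n = "card (UNIV :: 'g set)"
  have sing: "emeasure \<mu> {a} = emeasure \<mu> {0}" for a
    using haar_translate[OF \<mu>, of "{0}" a] by simp
  have "1 = emeasure \<mu> UNIV"
    using haar_UNIV[OF \<mu>] by simp
  also have "\<dots> = (\<Sum>a\<in>(UNIV :: 'g set). emeasure \<mu> {a})"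
    using fin sets by (intro emeasure_eq_sum_singleton) auto
  also have "\<dots> = (\<Sum>a\<in>(UNIV :: 'g set). emeasure \<mu> {0})"
    by (intro sum.cong refl sing)
  also have "\<dots> = of_nat ?n * emeasure \<mu> {0}"
    by simp
  finally have one: "1 = of_nat ?n * emeasure \<mu> {0}" .
  fix a :: 'g
  have n: "?n > 0"
    using fin by (simp add: card_gt_0_iff)
  have "ennreal (1 / ?n) * of_nat ?n = 1"
    using n by (simp add: ennreal_of_nat_eq_real_of_nat flip: ennreal_mult)
  then have "emeasure \<mu> {0} = ennreal (1 / ?n) * of_nat ?n * emeasure \<mu> {0}"
    by simp
  also have "\<dots> = ennreal (1 / ?n)"
    unfolding mult.assoc one[symmetric] by simp
  finally show "emeasure \<mu> {a} = emeasure (uniform_count_measure UNIV) {a}"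
    using fin sing[of a] by (simp add: emeasure_uniform_count_measure)
qed (rule fin)

section \<open>The convolution algebra and Fourier coefficients over a finite group\<close>

context
  fixes \<mu> :: "'g::{topological_ab_group_add, t2_space} measure" and p :: real and n :: nat
    and L :: "('g \<Rightarrow> 'a::{comm_complex_banach_algebra, second_countable_topology}) set calgebra"
  defines "n \<equiv> card (UNIV :: 'g set)" and "L \<equiv> lp_algebra \<mu> p"
  assumes fin: "finite (UNIV :: 'g set)" and \<mu>: "normalized_haar \<mu>" and p: "1 \<le> p"
begin

lemma n_pos: "n > 0"
  using fin by (simp add: n_def card_gt_0_iff)

lemma integral_haar_finite:
  fixes f :: "'g \<Rightarrow> 'b::{banach, second_countable_topology}"
  shows "(\<integral>x. f x \<partial>\<mu>) = scaleR (1 / n) (\<Sum>x\<in>UNIV. f x)"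
proof -
  have "(\<integral>x. f x \<partial>\<mu>) = (\<Sum>x\<in>UNIV. scaleR (1 / n) (f x))"
    unfolding haar_finite[OF fin \<mu>] uniform_count_measure_def n_def
    by (rule lebesgue_integral_point_measure_finite[OF fin]) simp
  then show ?thesis
    by (simp only: scaleR_sum_right)
qed

lemma lp_fun_finite: "(lp_fun \<mu> p :: ('g \<Rightarrow> 'a) set) = UNIV"
proof -
  have "f \<in> borel_measurable borel" for f :: "'g \<Rightarrow> 'a"
    using sets_borel_finite[OF fin] by (auto intro!: measurableI)
  moreover have "(\<integral>\<^sup>+x. ennreal (norm (f x) powr p) \<partial>\<mu>) < \<infinity>" for f :: "'g \<Rightarrow> 'a"
    unfolding haar_finite[OF fin \<mu>] uniform_count_measure_def
    using fin by (subst nn_integral_point_measure_finite)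
      (auto simp: ennreal_mult_less_top ennreal_sum_less_top simp flip: ennreal_mult)
  ultimately show ?thesis
    by (auto simp: lp_fun_def)
qed

text \<open>Every point has positive mass, so equality almost everywhere is equality.\<close>

lemma lp_class_finite: "lp_class \<mu> p f = {f :: 'g \<Rightarrow> 'a}"
proof -
  have "(AE x in \<mu>. f x = g x) \<longleftrightarrow> f = g" for g
    unfolding haar_finite[OF fin \<mu>] uniform_count_measure_def
    using fin by (auto simp: AE_point_measure card_gt_0_iff)
  then show ?thesis
    by (auto simp: lp_class_def lp_fun_finite)
qed

lemma rep_singleton: "rep {f} = f"
  by (simp add: rep_def)

lemma L_simps:
  "carrier L = range (\<lambda>f. {f})"
  "add L {f} {g} = {\<lambda>x. f x + g x}"
  "scale L c {f} = {\<lambda>x. scaleC c (f x)}"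
  "mult L {f} {g} = {\<lambda>x. scaleR (1 / n) (\<Sum>y\<in>UNIV. f y * g (- y + x))}"
  "nrm L {f} = ((\<Sum>x\<in>UNIV. norm (f x) powr p) / n) powr (1 / p)"
proof -
  have "lp_class \<mu> p = (\<lambda>f :: 'g \<Rightarrow> 'a. {f})"
    by (rule ext) (rule lp_class_finite)
  moreover have "convolution \<mu> f g = (\<lambda>x. scaleR (1 / n) (\<Sum>y\<in>UNIV. f y * g (- y + x)))"
    for f g :: "'g \<Rightarrow> 'a"
    by (rule ext) (simp only: convolution_def integral_haar_finite)
  moreover have "(\<integral>x. norm (f x) powr p \<partial>\<mu>) = (\<Sum>x\<in>UNIV. norm (f x) powr p) / n"
    for f :: "'g \<Rightarrow> 'a"
    unfolding integral_haar_finite by simp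
  ultimately show
    "carrier L = range (\<lambda>f. {f})"
    "add L {f} {g} = {\<lambda>x. f x + g x}"
    "scale L c {f} = {\<lambda>x. scaleC c (f x)}"
    "mult L {f} {g} = {\<lambda>x. scaleR (1 / n) (\<Sum>y\<in>UNIV. f y * g (- y + x))}"
    "nrm L {f} = ((\<Sum>x\<in>UNIV. norm (f x) powr p) / n) powr (1 / p)"
    by (simp_all only: L_def lp_algebra_def lp_fun_finite rep_singleton calgebra.simps)
qed

lemma nrm_L_le:
  assumes "\<And>x. norm (f x) \<le> M"
  shows "nrm L {f} \<le> M"
proof -
  have M: "M \<ge> 0"
    using norm_ge_zero[of "f 0"] assms[of 0] by linarith
  have "(\<Sum>x\<in>UNIV. norm (f x) powr p) \<le> (\<Sum>x\<in>(UNIV :: 'g set). M powr p)"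
    using assms p by (intro sum_mono powr_mono2) auto
  then have "(\<Sum>x\<in>UNIV. norm (f x) powr p) / n \<le> M powr p"
    using n_pos by (simp add: n_def[symmetric] field_simps)
  then have "nrm L {f} \<le> (M powr p) powr (1 / p)"
    unfolding L_simps using p by (intro powr_mono2) (simp_all add: sum_nonneg)
  then show ?thesis
    using p M by (simp add: powr_powr)
qed

text \<open>One summand is at most the whole sum, which costs \<open>n powr (1 / p)\<close>; since
  \<open>p \<ge> 1\<close> this is at most \<open>n\<close>, a bound free of
  \<open>p\<close>.\<close>

lemma norm_le_nrm_L: "norm (f x) \<le> n * nrm L {f}"
proof -
  let ?S = "(\<Sum>x\<in>UNIV. norm (f x) powr p) / n"
  have "norm (f x) powr p \<le> (\<Sum>x\<in>UNIV. norm (f x) powr p)"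
    using fin by (intro member_le_sum) auto
  then have "norm (f x) powr p \<le> n * ?S"
    using n_pos by simp
  then have "(norm (f x) powr p) powr (1 / p) \<le> (n * ?S) powr (1 / p)"
    using p by (intro powr_mono2) auto
  also have "\<dots> = n powr (1 / p) * nrm L {f}"
    unfolding L_simps by (rule powr_mult)
  also have "\<dots> \<le> n * nrm L {f}"
  proof (rule mult_right_mono)
    show "n powr (1 / p) \<le> n"
      using powr_mono[of "1 / p" 1 "real n"] n_pos p by simp
  qed (simp add: L_simps)
  finally show ?thesis
    using p by (simp add: powr_powr)
qed

lemma normed_scale_L: "normed_scale L"
  unfolding normed_scale_def
proof (intro allI ballI)
  fix c F assume "F \<in> carrier L"
  then obtain f where F: "F = {f}"
    by (auto simp: L_simps)
  have "nrm L (scale L c F) = (cmod c powr p * ((\<Sum>x\<in>UNIV. norm (f x) powr p) / n)) powr (1 / p)"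
    by (simp add: F L_simps norm_scaleC powr_mult sum_distrib_left)
  also have "\<dots> = cmod c * nrm L F"
    unfolding F L_simps using p by (subst powr_mult) (simp add: powr_powr)
  finally show "scale L c F \<in> carrier L \<and> nrm L (scale L c F) = cmod c * nrm L F"
    by (simp add: F L_simps)
qed

text \<open>The \<open>A\<close>-valued Fourier coefficient with respect to normalised counting
  measure; \<open>\<xi> (- y)\<close> stands for the complex conjugate of
  \<open>\<xi> y\<close>.\<close>

definition fourier :: "('g \<Rightarrow> complex) \<Rightarrow> ('g \<Rightarrow> 'a) \<Rightarrow> 'a" where
  "fourier \<xi> f = scaleC (1 / of_nat n) (\<Sum>y\<in>UNIV. scaleC (\<xi> (- y)) (f y))"

lemma scaleR_inverse_n: "scaleR (1 / n) x = scaleC (1 / of_nat n) (x :: 'a)"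
  using scaleC_of_real[of "1 / n" x] by simp

text \<open>Substituting \<open>x = y + z\<close> splits the character value, and the double sum
  factors.\<close>

lemma fourier_convolution:
  assumes "\<xi> \<in> group_characters"
  shows "fourier \<xi> (\<lambda>x. scaleR (1 / n) (\<Sum>y\<in>UNIV. f y * g (- y + x))) = fourier \<xi> f * fourier \<xi> g"
proof -
  have mul: "\<xi> (- x - y) = \<xi> (- y) * \<xi> (- x)" for x y
    using group_character_diff[OF assms, of "- x" y] by (simp add: mult.commute)
  have "(\<Sum>x\<in>UNIV. scaleC (\<xi> (- x)) (f y * g (- y + x))) =
      scaleC (\<xi> (- y)) (f y) * (\<Sum>z\<in>UNIV. scaleC (\<xi> (- z)) (g z))" for y
  proof -
    have "(\<Sum>x\<in>UNIV. scaleC (\<xi> (- x)) (f y * g (- y + x))) =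
        (\<Sum>z\<in>UNIV. scaleC (\<xi> (- y - z)) (f y * g z))"
      by (rule sum.reindex_bij_witness[of _ "\<lambda>z. y + z" "\<lambda>x. - y + x"]) (auto simp: add_ac)
    then show ?thesis
      by (simp add: mul sum_distrib_left scaleC_mult_left scaleC_mult_right scaleC_scaleC)
  qed
  then have double: "(\<Sum>x\<in>UNIV. \<Sum>y\<in>UNIV. scaleC (\<xi> (- x)) (f y * g (- y + x))) =
      (\<Sum>y\<in>UNIV. scaleC (\<xi> (- y)) (f y)) * (\<Sum>z\<in>UNIV. scaleC (\<xi> (- z)) (g z))"
    by (subst sum.swap) (simp add: sum_distrib_right)
  have "fourier \<xi> (\<lambda>x. scaleR (1 / n) (\<Sum>y\<in>UNIV. f y * g (- y + x))) =
      scaleC (1 / of_nat n) (scaleC (1 / of_nat n)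
        (\<Sum>x\<in>UNIV. \<Sum>y\<in>UNIV. scaleC (\<xi> (- x)) (f y * g (- y + x))))"
    by (simp only: fourier_def scaleR_inverse_n scaleC_sum_right scaleC_scaleC mult_ac)
  then show ?thesis
    unfolding double by (simp add: fourier_def scaleC_mult_left scaleC_mult_right)
qed

lemma alg_hom_fourier:
  assumes "\<xi> \<in> group_characters"
  shows "alg_hom L type_algebra (\<lambda>F. fourier \<xi> (rep F))"
proof -
  have "fourier \<xi> (\<lambda>x. f x + g x) = fourier \<xi> f + fourier \<xi> g" for f g
    by (simp add: fourier_def scaleC_add_right sum.distrib)
  moreover have "fourier \<xi> (\<lambda>x. scaleC c (f x)) = scaleC c (fourier \<xi> f)" for c f
    by (simp add: fourier_def scaleC_scaleC mult.commute scaleC_sum_right)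
  ultimately show ?thesis
    using fourier_convolution[OF assms]
    by (auto simp: alg_hom_def type_algebra_def L_simps rep_singleton)
qed

lemma norm_fourier_le:
  assumes "\<xi> \<in> group_characters"
  shows "norm (fourier \<xi> f) \<le> n * nrm L {f}"
proof -
  have "norm (\<Sum>y\<in>UNIV. scaleC (\<xi> (- y)) (f y)) \<le> (\<Sum>y\<in>(UNIV :: 'g set). n * nrm L {f})"
    using norm_le_nrm_L norm_group_character[OF fin assms]
    by (intro sum_norm_le) (simp add: norm_scaleC)
  then show ?thesis
    using n_pos by (simp add: fourier_def norm_scaleC norm_divide n_def[symmetric] field_simps)
qed

text \<open>After exchanging the sums, orthogonality leaves only \<open>y = x\<close>. Both
  cardinalities stay as factors, so the characters need not be counted.\<close>

lemma fourier_inversion: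
  "scaleC (of_nat (card (group_characters :: ('g \<Rightarrow> complex) set))) (f x) =
     scaleC (of_nat n) (\<Sum>\<xi>\<in>group_characters. scaleC (\<xi> x) (fourier \<xi> f))"
proof -
  let ?\<Gamma> = "group_characters :: ('g \<Rightarrow> complex) set"
  note mul = group_character_diff[of _ x, symmetric]
  have "scaleC (of_nat n) (\<Sum>\<xi>\<in>?\<Gamma>. scaleC (\<xi> x) (fourier \<xi> f)) =
      (\<Sum>\<xi>\<in>?\<Gamma>. \<Sum>y\<in>UNIV. scaleC (\<xi> (x - y)) (f y))"
    using n_pos by (simp add: fourier_def scaleC_sum_right scaleC_scaleC mul)
  also have "\<dots> = (\<Sum>y\<in>UNIV. scaleC (\<Sum>\<xi>\<in>?\<Gamma>. \<xi> (x - y)) (f y))"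
    by (subst sum.swap) (simp add: scaleC_sum_left)
  also have "\<dots> = (\<Sum>y\<in>{x}. scaleC (\<Sum>\<xi>\<in>?\<Gamma>. \<xi> (x - y)) (f y))"
    using fin by (intro sum.mono_neutral_right) (auto simp: sum_group_characters[OF fin] scaleC_zero)
  also have "\<dots> = scaleC (of_nat (card ?\<Gamma>)) (f x)"
    by (simp add: sum_group_characters[OF fin])
  finally show ?thesis
    by simp
qed

lemma norm_le_sum_fourier:
  "norm (f x) \<le> n * (\<Sum>\<xi>\<in>group_characters. norm (fourier \<xi> f))"
proof -
  let ?\<Gamma> = "group_characters :: ('g \<Rightarrow> complex) set"
  have "(\<lambda>_. 1) \<in> ?\<Gamma>"
    by (simp add: group_characters_def)
  then have "1 \<le> card ?\<Gamma>"
    using finite_group_characters[OF fin] by (auto simp: Suc_le_eq card_gt_0_iff)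
  then have "norm (f x) \<le> card ?\<Gamma> * norm (f x)"
    by (intro mult_le_cancel_right1[THEN iffD2]) auto
  also have "\<dots> = n * norm (\<Sum>\<xi>\<in>?\<Gamma>. scaleC (\<xi> x) (fourier \<xi> f))"
    using arg_cong[OF fourier_inversion[of f x], of norm] by (simp add: norm_scaleC)
  also have "\<dots> \<le> n * (\<Sum>\<xi>\<in>?\<Gamma>. norm (fourier \<xi> f))"
    using norm_group_character[OF fin] by (intro mult_left_mono sum_norm_le) (auto simp: norm_scaleC)
  finally show ?thesis .
qed

lemma bse_norm_algebra_lp_finite:
  assumes "bse_norm_algebra (type_algebra :: 'a calgebra)"
  shows "bse_norm_algebra L"
proof -
  let ?A = "type_algebra :: 'a calgebra"
  let ?\<Gamma> = "group_characters :: ('g \<Rightarrow> complex) set"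
  obtain K where K: "K > 0" "\<And>a. norm a \<le> K * bse_norm ?A a"
    using assms by (auto simp: bse_norm_algebra_def type_algebra_def)
  \<comment> \<open>From left to right: \<open>n\<close> from \<open>norm_le_sum_fourier\<close>,
    the number of coefficients, \<open>K\<close> from the algebra \<open>A\<close>, and the bound
    \<open>n\<close> of each coefficient homomorphism.\<close>
  define C where "C = n * (card ?\<Gamma> * (K * n))"
  have "(\<lambda>_. 1) \<in> ?\<Gamma>"
    by (simp add: group_characters_def)
  then have "card ?\<Gamma> > 0"
    using finite_group_characters[OF fin] by (auto simp: card_gt_0_iff)
  then have C: "C > 0"
    using K n_pos by (simp add: C_def)
  have "nrm L {f} \<le> C * bse_norm L {f}" for f
  proof (rule nrm_L_le)
    fix x
    have "norm (fourier \<xi> f) \<le> K * (n * bse_norm L {f})" if \<xi>: "\<xi> \<in> ?\<Gamma>" for \<xi>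
    proof -
      have "bse_norm ?A (fourier \<xi> (rep {f})) \<le> n * bse_norm L {f}"
        using n_pos norm_fourier_le[OF \<xi>]
        by (intro bse_norm_hom[OF normed_scale_L alg_hom_fourier[OF \<xi>]])
          (auto simp: L_simps(1) rep_singleton type_algebra_def)
      then have "K * bse_norm ?A (fourier \<xi> f) \<le> K * (n * bse_norm L {f})"
        using K(1) by (simp add: rep_singleton)
      then show ?thesis
        using K(2)[of "fourier \<xi> f"] by linarith
    qed
    then have "(\<Sum>\<xi>\<in>?\<Gamma>. norm (fourier \<xi> f)) \<le> card ?\<Gamma> * (K * (n * bse_norm L {f}))"
      by (rule sum_bounded_above)
    then have "n * (\<Sum>\<xi>\<in>?\<Gamma>. norm (fourier \<xi> f)) \<le> C * bse_norm L {f}"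
      unfolding C_def using mult_left_mono[of _ _ "real n"] by (simp add: mult.assoc)
    then show "norm (f x) \<le> C * bse_norm L {f}"
      using norm_le_sum_fourier[of f x] by linarith
  qed
  then show ?thesis
    using C by (auto simp: bse_norm_algebra_def L_simps(1))
qed

end

theorem theorem4p2:
  fixes \<mu> :: "'g::{topological_ab_group_add, t2_space} measure"
    and p :: real
  assumes "semisimple (type_algebra ::
      'a::{comm_complex_banach_algebra, second_countable_topology} calgebra)"
    and "unital (type_algebra :: 'a calgebra)"
    and "compact (UNIV :: 'g set)"
    and "normalized_haar \<mu>"
    and "1 \<le> p"
  shows "(bse_norm_algebra (lp_algebra \<mu> p :: ('g \<Rightarrow> 'a) set calgebra) \<longrightarrow>
           bse_norm_algebra (type_algebra :: 'a calgebra)) \<and>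
         (finite (UNIV :: 'g set) \<and> bse_norm_algebra (type_algebra :: 'a calgebra) \<longrightarrow>
           bse_norm_algebra (lp_algebra \<mu> p :: ('g \<Rightarrow> 'a) set calgebra))"
  using bse_norm_algebra_coefficients[OF assms(3-5)] bse_norm_algebra_lp_finite[OF _ assms(4,5)]
  by blast

end
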